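(* Let $n$ be a sufficiently large integer and let $q = q(n) \geq 0.49 n$ be an integer. Then, playing the $(q:1)$ Waiter-Client game on $E(K_n)$, Client has a strategy to ensure that, at the end of the game, the minimum degree of his graph is at most one.
   Context: The $(q:1)$ Waiter-Client game on $E(K_n)$ (for a positive integer $q$) is the following two-player perfect information game. In each round, Waiter offers Client exactly $q+1$ edges of the complete graph $K_n$ which have not been claimed before; Client chooses one of these edges, which he keeps, and the remaining $q$ edges are claimed by Waiter. If fewer than $q+1$ unclaimed edges remain, all of them are claimed by Waiter. The game ends when all edges of $K_n$ have been claimed. Client's graph is the graph with vertex set $V(K_n)$ whose edges are all the edges claimed by Client. *)

theory Defs
  imports Complex_Main
begin

definition complete_edges :: "'v set \<Rightarrow> 'v set set" where
  "complete_edges V = {e. e \<subseteq> V \<and> card e = 2}"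

definition degree :: "'v set set \<Rightarrow> 'v \<Rightarrow> nat" where
  "degree E v = card {e \<in> E. v \<in> e}"

definition min_degree :: "'v set \<Rightarrow> 'v set set \<Rightarrow> nat" where
  "min_degree V E = Min (degree E ` V)"

(* A history of the Waiter-Client game on a finite board X lists, in chronological
   order, the rounds (A, e): Waiter offers the set A and Client keeps e. *)

type_synonym 'e history = "('e set \<times> 'e) list"

definition claimed :: "'e history \<Rightarrow> 'e set" where
  "claimed h = (\<Union>(A, e) \<in> set h. A)"

definition client_edges :: "'e history \<Rightarrow> 'e set" where
  "client_edges h = snd ` set h"

definition legal_offer :: "'e set \<Rightarrow> nat \<Rightarrow> 'e history \<Rightarrow> 'e set \<Rightarrow> bool" where
  "legal_offer X q h A \<longleftrightarrow> A \<subseteq> X - claimed h \<and> card A = q + 1"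

inductive legal_history :: "'e set \<Rightarrow> nat \<Rightarrow> 'e history \<Rightarrow> bool" for X q where
  start: "legal_history X q []"
| round: "legal_history X q h \<Longrightarrow> legal_offer X q h A \<Longrightarrow> e \<in> A
    \<Longrightarrow> legal_history X q (h @ [(A, e)])"

(* When at most q elements are unclaimed, Waiter takes all of them, so that
   Client's final set is already determined. *)

definition finished :: "'e set \<Rightarrow> nat \<Rightarrow> 'e history \<Rightarrow> bool" where
  "finished X q h \<longleftrightarrow> legal_history X q h \<and> card (X - claimed h) < q + 1"

type_synonym 'e strategy = "'e history \<Rightarrow> 'e set \<Rightarrow> 'e"

definition client_strategy :: "'e set \<Rightarrow> nat \<Rightarrow> 'e strategy \<Rightarrow> bool" where
  "client_strategy X q \<sigma> \<longleftrightarrow>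
     (\<forall>h A. legal_history X q h \<and> legal_offer X q h A \<longrightarrow> \<sigma> h A \<in> A)"

definition follows :: "'e strategy \<Rightarrow> 'e history \<Rightarrow> bool" where
  "follows \<sigma> h \<longleftrightarrow> (\<forall>i < length h. snd (h ! i) = \<sigma> (take i h) (fst (h ! i)))"

definition client_can_ensure :: "'e set \<Rightarrow> nat \<Rightarrow> ('e set \<Rightarrow> bool) \<Rightarrow> bool" where
  "client_can_ensure X q P \<longleftrightarrow>
     (\<exists>\<sigma>. client_strategy X q \<sigma> \<and>
          (\<forall>h. finished X q h \<and> follows \<sigma> h \<longrightarrow> P (client_edges h)))"

end

(* Client takes, whenever he can, an offered edge with an endpoint whose degree is already at least
   two. Suppose that all degrees end up at least two. A round lowers the deficit (the sum over all
   vertices of 2 - degree, truncated at 0) by at most two, and by at most one if Client could apply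
   his preference. The deficit starts at 2n and there are at most 50n/49 rounds, so the preference
   applies in at most 2n/49 rounds. With r = n/8 rounds to go the deficit is at most 2r, hence so is
   the number of vertices of degree at most one. In all remaining rounds but 2n/49, the whole offer
   consists of edges between these vertices; so (r - 2n/49) (q + 1) <= 2 r^2, which is false. *)

theory Submission
  imports Defs
begin

section \<open>Edge counts and the disjointness of offers\<close>

lemma finite_complete_edges: "finite V \<Longrightarrow> finite (complete_edges V)"
  unfolding complete_edges_def by (rule finite_subset[of _ "Pow V"]) auto

lemma card_complete_edges: "finite V \<Longrightarrow> card (complete_edges V) = card V choose 2"
  unfolding complete_edges_def by (rule n_subsets)

lemma real_choose_two: "real (m choose 2) = real m * (real m - 1) / 2"
  by (cases m) (simp_all add: choose_two real_of_nat_div algebra_simps)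

lemma claimed_conv_nth: "claimed h = (\<Union>i<length h. fst (h ! i))"
  by (auto simp: claimed_def set_conv_nth case_prod_unfold)

lemma client_edges_take_Suc:
  "i < length h \<Longrightarrow> client_edges (take (Suc i) h) = insert (snd (h ! i)) (client_edges (take i h))"
  by (simp add: client_edges_def take_Suc_conv_app_nth)

lemma client_edges_take_mono: "i \<le> j \<Longrightarrow> client_edges (take i h) \<subseteq> client_edges (take j h)"
  unfolding client_edges_def by (intro image_mono set_take_subset_set_take)

lemma legal_history_nth:
  assumes "legal_history X q h" "i < length h"
  shows "legal_offer X q (take i h) (fst (h ! i))
    \<and> snd (h ! i) \<in> fst (h ! i)"
  using assms
proof (induction rule: legal_history.induct)
  case (round h A e)
  then show ?case by (cases "i < length h") (auto simp: nth_append less_Suc_eq)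
qed simp

text \<open>The earlier of two offers is already claimed when the later one is made, and a legal
  offer avoids claimed edges.\<close>

lemma legal_history_disjoint:
  assumes "legal_history X q h" "i < length h" "j < length h" "i \<noteq> j"
  shows "fst (h ! i) \<inter> fst (h ! j) = {}"
proof -
  have "fst (h ! i) \<inter> fst (h ! j) = {}" if "i < j" "j < length h" for i j
  proof -
    have "fst (h ! i) \<subseteq> claimed (take j h)"
      using that by (auto simp: claimed_conv_nth)
    then show ?thesis
      using legal_history_nth[OF assms(1) that(2)] by (auto simp: legal_offer_def)
  qed
  then show ?thesis
    using assms(2-4) by (metis inf_commute linorder_neqE_nat)
qed

lemma card_offers:
  assumes "finite X" "legal_history X q h" "S \<subseteq> {..<length h}"
  shows "card (\<Union>i\<in>S. fst (h ! i)) = card S * (q + 1)"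
proof -
  have offer: "fst (h ! i) \<subseteq> X \<and> card (fst (h ! i)) = q + 1" if "i \<in> S" for i
    using legal_history_nth[OF assms(2), of i] that assms(3) by (auto simp: legal_offer_def)
  have "card (\<Union>i\<in>S. fst (h ! i)) = (\<Sum>i\<in>S. card (fst (h ! i)))"
  proof (rule card_UN_disjoint)
    show "finite S" using assms(3) finite_subset by blast
    show "\<forall>i\<in>S. finite (fst (h ! i))" using offer assms(1) finite_subset by blast
    show "\<forall>i\<in>S. \<forall>j\<in>S. i \<noteq> j \<longrightarrow> fst (h ! i) \<inter> fst (h ! j) = {}"
      using legal_history_disjoint[OF assms(2)] assms(3) by blast
  qed
  also have "\<dots> = card S * (q + 1)" using offer by simp
  finally show ?thesis .
qed

text \<open>This is used with two choices of \<open>Y\<close>: the whole board bounds the number of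
  rounds, and the edges between vertices of low degree bound the late rounds that offer only such
  edges.\<close>

lemma card_offers_le:
  assumes "finite X" "legal_history X q h" "S \<subseteq> {..<length h}"
    "finite Y" "\<And>i. i \<in> S \<Longrightarrow> fst (h ! i) \<subseteq> Y"
  shows "card S * (q + 1) \<le> card Y"
  unfolding card_offers[OF assms(1-3), symmetric] using assms(4,5) by (intro card_mono) auto

section \<open>Degrees and the deficit\<close>

lemma finite_client_edges: "finite (client_edges h)"
  by (simp add: client_edges_def)

lemma degree_mono: "finite E' \<Longrightarrow> E \<subseteq> E' \<Longrightarrow> degree E v \<le> degree E' v"
  unfolding degree_def by (intro card_mono) auto

lemma degree_insert_le: "degree (insert e E) v \<le> degree E v + (if v \<in> e then 1 else 0)"
proof (cases "v \<in> e")
  case True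
  then have "{e' \<in> insert e E. v \<in> e'} = insert e {e' \<in> E. v \<in> e'}" by auto
  then show ?thesis using True by (simp add: degree_def card_insert_le_m1)
next
  case False
  then have "{e' \<in> insert e E. v \<in> e'} = {e' \<in> E. v \<in> e'}" by auto
  then show ?thesis by (simp add: degree_def)
qed

definition deficit :: "'v set \<Rightarrow> 'v set set \<Rightarrow> nat" where
  "deficit V E = (\<Sum>v\<in>V. 2 - degree E v)"

lemma deficit_empty: "deficit V {} = 2 * card V"
  by (simp add: deficit_def degree_def)

lemma card_low_degree_le_deficit: "finite V \<Longrightarrow> card {v \<in> V. degree E v < 2} \<le> deficit V E"
proof -
  assume V: "finite V"
  have "card {v \<in> V. degree E v < 2} = (\<Sum>v\<in>V. if degree E v < 2 then 1 else 0)"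
    using V by (simp add: sum.If_cases Int_def)
  also have "\<dots> \<le> deficit V E"
    unfolding deficit_def by (intro sum_mono) auto
  finally show ?thesis .
qed

text \<open>Degrees rise by at most one and only at endpoints of \<open>e\<close>, and a truncated
  term that is already 0 cannot drop.\<close>

lemma deficit_insert:
  assumes "finite V" "finite e"
  shows "deficit V E \<le> deficit V (insert e E) + card {v \<in> e. degree E v < 2}"
proof -
  have "deficit V E \<le> (\<Sum>v\<in>V. (2 - degree (insert e E) v) + (if v \<in> e \<and> degree E v < 2 then 1 else 0))"
    unfolding deficit_def
  proof (intro sum_mono)
    fix v
    show "2 - degree E v \<le> (2 - degree (insert e E) v) + (if v \<in> e \<and> degree E v < 2 then 1 else 0)"
      using degree_insert_le[of e E v] by (auto split: if_splits)
  qed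
  also have "\<dots> = deficit V (insert e E) + card {v \<in> V. v \<in> e \<and> degree E v < 2}"
    using assms(1) by (simp add: deficit_def sum.distrib sum.If_cases Int_def)
  also have "card {v \<in> V. v \<in> e \<and> degree E v < 2} \<le> card {v \<in> e. degree E v < 2}"
    using assms(2) by (intro card_mono) auto
  finally show ?thesis by simp
qed

lemma deficit_insert_edge:
  assumes "finite V" "card e = 2"
  shows "deficit V E \<le> deficit V (insert e E) + (if \<exists>v\<in>e. degree E v \<ge> 2 then 1 else 2)"
proof -
  have e: "finite e" using assms(2) card.infinite by fastforce
  have "card {v \<in> e. degree E v < 2} \<le> (if \<exists>v\<in>e. degree E v \<ge> 2 then 1 else 2)"
  proof (cases "\<exists>v\<in>e. degree E v \<ge> 2")
    case True
    then have "{v \<in> e. degree E v < 2} \<subset> e" by force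
    from psubset_card_mono[OF e this] have "card {v \<in> e. degree E v < 2} < 2" using assms(2) by simp
    then show ?thesis using True by simp
  next
    case False
    then show ?thesis using card_mono[OF e, of "{v \<in> e. degree E v < 2}"] assms(2) by auto
  qed
  then show ?thesis using deficit_insert[OF assms(1) e, of E] by linarith
qed

section \<open>Client's strategy and the bounds on its play\<close>

definition saturated :: "'v set set \<Rightarrow> 'v set \<Rightarrow> bool" where
  "saturated E e \<longleftrightarrow> (\<exists>v\<in>e. degree E v \<ge> 2)"

text \<open>The implication makes every edge of an offer without saturated edges eligible, so
  \<open>SOME\<close> has a witness for each nonempty offer.\<close>

definition wasteful :: "'v set strategy" where
  "wasteful h A = (SOME e. e \<in> A \<and>
     ((\<exists>f\<in>A. saturated (client_edges h) f) \<longrightarrow> saturated (client_edges h) e))"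

lemma wasteful:
  assumes "A \<noteq> {}"
  shows "wasteful h A \<in> A"
    and "f \<in> A \<Longrightarrow> saturated (client_edges h) f \<Longrightarrow> saturated (client_edges h) (wasteful h A)"
proof -
  have "\<exists>e. e \<in> A \<and> ((\<exists>f\<in>A. saturated (client_edges h) f) \<longrightarrow> saturated (client_edges h) e)"
    using assms by blast
  from someI_ex[OF this] show "wasteful h A \<in> A"
    and "f \<in> A \<Longrightarrow> saturated (client_edges h) f \<Longrightarrow> saturated (client_edges h) (wasteful h A)"
    unfolding wasteful_def by blast+
qed

lemma client_strategy_wasteful: "client_strategy X q wasteful"
  unfolding client_strategy_def legal_offer_def by (auto intro!: wasteful(1))

text \<open>The witness for \<open>b\<close> is the number of rounds in which the kept edge was
  saturated just before Client took it. Both bounds concern the same \<open>b\<close>, so a small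
  \<open>b\<close> from the first can be fed into the second.\<close>

lemma wasteful_play_bounds:
  assumes V: "finite V"
    and h: "legal_history (complete_edges V) q h" "follows wasteful h"
    and final: "\<And>v. v \<in> V \<Longrightarrow> degree (client_edges h) v \<ge> 2"
    and r: "r \<le> length h"
  obtains b where "2 * card V + b \<le> 2 * length h" "(r - b) * (q + 1) \<le> (2 * r) choose 2"
proof -
  define R where "R = length h"
  define E where "E i = client_edges (take i h)" for i
  define B where "B = {i. i < R \<and> saturated (E i) (snd (h ! i))}"
  have offer: "fst (h ! i) \<subseteq> complete_edges V \<and> snd (h ! i) \<in> fst (h ! i)" if "i < R" for i
    using legal_history_nth[OF h(1)] that by (auto simp: legal_offer_def R_def)
  have round_deficit: "deficit V (E i) \<le> (if i \<in> B then 1 else 2) + deficit V (E (Suc i))" if "i < R" for i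
  proof -
    have "card (snd (h ! i)) = 2" using offer[OF that] by (auto simp: complete_edges_def)
    then show ?thesis
      using deficit_insert_edge[OF V, of "snd (h ! i)" "E i"] that
      by (auto simp: E_def client_edges_take_Suc R_def B_def saturated_def)
  qed
  have deficit_R: "deficit V (E R) = 0"
    using final by (auto simp: deficit_def E_def R_def)
  have deficit_le: "deficit V (E i) \<le> (\<Sum>j=i..<R. if j \<in> B then 1 else 2)" if "i \<le> R" for i
    using that
  \<comment> \<open>The induction runs backwards from the end of play, where the deficit is
    0.\<close>
  proof (induction i rule: inc_induct)
    case (step m)
    then show ?case
      using round_deficit[of m]
      by (simp add: sum.atLeast_Suc_lessThan)
  qed (simp add: deficit_R)
  have bound0: "2 * card V + card B \<le> 2 * R"
  proof -
    \<comment> \<open>Adding the indicator of \<open>B\<close> gives every round the same weight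
      2.\<close>
    have "2 * card V + card B \<le> (\<Sum>j<R. if j \<in> B then 1 else 2) + (\<Sum>j<R. if j \<in> B then 1 else 0)"
    proof -
      have "{..<R} \<inter> B = B" by (auto simp: B_def)
      moreover have "2 * card V \<le> (\<Sum>j<R. if j \<in> B then 1 else 2)"
        using deficit_le[of 0] by (simp add: E_def client_edges_def deficit_empty atLeast0LessThan)
      ultimately show ?thesis by (simp add: sum.If_cases)
    qed
    also have "\<dots> = (\<Sum>j<R. 2)" unfolding sum.distrib[symmetric] by (intro sum.cong) auto
    finally show ?thesis by simp
  qed
  define s where "s = R - r"
  define L where "L = {v \<in> V. degree (E s) v < 2}"
  have "card L \<le> deficit V (E s)" unfolding L_def by (rule card_low_degree_le_deficit[OF V])
  also have "\<dots> \<le> (\<Sum>j=s..<R. 2)"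
    by (rule order_trans[OF deficit_le], simp add: s_def, intro sum_mono, simp)
  also have "\<dots> = 2 * r" using r by (simp add: s_def R_def)
  finally have L: "card L \<le> 2 * r" .
  have "fst (h ! i) \<subseteq> complete_edges L" if i: "i \<in> {s..<R} - B" for i
  proof
    fix e assume e: "e \<in> fst (h ! i)"
    have "snd (h ! i) = wasteful (take i h) (fst (h ! i))"
      using h(2) i by (simp add: follows_def R_def)
    \<comment> \<open>Outside \<open>B\<close> Client kept an unsaturated edge, so his preference
      found no saturated edge in the whole offer.\<close>
    then have "\<not> saturated (E i) e"
      using wasteful(2)[OF _ e, of "take i h"] e i by (auto simp: B_def E_def)
    \<comment> \<open>Degrees never decrease, so endpoints that are low at time \<open>i\<close>
      were already low at time \<open>s\<close>. The single set \<open>L\<close> thus serves all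
      late rounds.\<close>
    moreover have "degree (E s) v \<le> degree (E i) v" for v
      using i unfolding E_def by (intro degree_mono finite_client_edges client_edges_take_mono) auto
    ultimately have "\<forall>v\<in>e. degree (E s) v < 2"
      unfolding saturated_def by (meson le_less_trans not_le)
    then show "e \<in> complete_edges L"
      using offer[of i] i e by (auto simp: complete_edges_def L_def)
  qed
  then have "card ({s..<R} - B) * (q + 1) \<le> card (complete_edges L)"
    using V by (intro card_offers_le[OF finite_complete_edges[OF V] h(1)] finite_complete_edges)
      (auto simp: R_def L_def)
  also have "\<dots> \<le> (2 * r) choose 2"
    using L V by (simp add: card_complete_edges L_def binomial_right_mono)
  finally have "card ({s..<R} - B) * (q + 1) \<le> (2 * r) choose 2" .
  moreover have "r - card B \<le> card ({s..<R} - B)"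
    using diff_card_le_card_Diff[of B "{s..<R}"] r by (simp add: B_def s_def R_def)
  ultimately have "(r - card B) * (q + 1) \<le> (2 * r) choose 2"
    using mult_le_mono1 order_trans by blast
  then show thesis using that bound0 by (simp add: R_def)
qed

section \<open>The numerical contradiction\<close>

lemma no_wasteful_play_arithmetic:
  fixes n q R b :: nat
  assumes n: "n \<ge> 50" and q: "real q \<ge> 0.49 * real n"
    and R: "R * (q + 1) \<le> n choose 2"
    and b: "2 * n + b \<le> 2 * R" "(n div 8 - b) * (q + 1) \<le> (2 * (n div 8)) choose 2"
  shows False
proof -
  define x r where "x = real n" and "r = real (n div 8)"
  have x: "x \<ge> 50" using n by (simp add: x_def)
  have r: "8 * r \<le> x" "x < 8 * r + 8"
    unfolding x_def r_def by linarith+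
  have "real R * (0.49 * x) \<le> real R * real (q + 1)"
    using q by (intro mult_left_mono) (auto simp: x_def)
  also have "\<dots> \<le> real (n choose 2)" using R by (metis of_nat_le_iff of_nat_mult)
  also have "\<dots> \<le> x / 2 * x" using x by (simp add: real_choose_two x_def)
  finally have "(0.49 * real R) * x \<le> (x / 2) * x" by (simp add: mult_ac)
  then have "0.49 * real R \<le> x / 2" using x by (subst (asm) mult_le_cancel_right) auto
  moreover have "2 * x + real b \<le> 2 * real R" using b(1) unfolding x_def by linarith
  \<comment> \<open>Here \<open>R\<close> is at most x / 0.98 = 50 x / 49, so \<open>b\<close> is at
    most 2 R - 2 x, hence at most 2 x / 49.\<close>
  ultimately have "real b \<le> 2 * x / 49" by simp
  \<comment> \<open>The coefficient is 1/8 - 2/49 = 33/392, and the 1 pays for rounding in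
    \<open>n div 8\<close>.\<close>
  then have d: "33 * x / 392 - 1 \<le> real (n div 8 - b)" using r unfolding r_def by linarith
  have "(33 * x / 392 - 1) * (0.49 * x) \<le> real (n div 8 - b) * real (q + 1)"
    using d q x by (intro mult_mono) (auto simp: x_def)
  also have "\<dots> \<le> real ((2 * (n div 8)) choose 2)" using b(2) by (metis of_nat_le_iff of_nat_mult)
  also have "\<dots> \<le> 2 * (r * r)"
    unfolding real_choose_two by (simp add: r_def algebra_simps)
  also have "\<dots> \<le> 2 * (x / 8 * (x / 8))"
    using r by (intro mult_left_mono mult_mono) (auto simp: r_def x_def)
  \<comment> \<open>The quadratic coefficients are 0.49 * 33/392 = 0.04125 and 2/64 = 0.03125. What
    remains is 0.01 x^2 \<le> 0.49 x, which fails from x = 50 on; this is the source of the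
    threshold 50.\<close>
  finally have "x * x \<le> 49 * x" by (simp add: field_simps)
  then show False using x by simp
qed

theorem proposition1p5:
  "\<exists>N::nat. \<forall>n\<ge>N. \<forall>q::nat. real q \<ge> 0.49 * real n \<longrightarrow>
     client_can_ensure (complete_edges {..<n}) q (\<lambda>E. min_degree {..<n} E \<le> 1)"
proof (intro exI[of _ 50] allI impI)
  fix n q :: nat
  assume n: "n \<ge> 50" and q: "real q \<ge> 0.49 * real n"
  let ?X = "complete_edges {..<n}"
  have "min_degree {..<n} (client_edges h) \<le> 1" if h: "legal_history ?X q h" "follows wasteful h" for h
  proof (rule ccontr)
    assume "\<not> ?thesis"
    then have "Min (degree (client_edges h) ` {..<n}) \<ge> 2" by (simp add: min_degree_def)
    then have final: "degree (client_edges h) v \<ge> 2" if "v \<in> {..<n}" for v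
      using that n by (subst (asm) Min_ge_iff) auto
    have "card {..<length h} * (q + 1) \<le> card ?X"
      using h(1) legal_history_nth[OF h(1)]
      by (intro card_offers_le) (auto simp: legal_offer_def finite_complete_edges)
    then have R: "length h * (q + 1) \<le> n choose 2" by (simp add: card_complete_edges)
    \<comment> \<open>With \<open>r\<close> = 0 the first bound shows that there are at least
      \<open>n\<close> rounds, which makes \<open>r\<close> = \<open>n div 8\<close> admissible
      below.\<close>
    obtain b where "2 * n + b \<le> 2 * length h"
      using wasteful_play_bounds[OF _ h final, of 0] by auto
    then have "n div 8 \<le> length h" by linarith
    from wasteful_play_bounds[OF _ h final this]
    obtain b where "2 * n + b \<le> 2 * length h" "(n div 8 - b) * (q + 1) \<le> (2 * (n div 8)) choose 2"
      by auto
    then show False using no_wasteful_play_arithmetic[OF n q R] by blast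
  qed
  then show "client_can_ensure ?X q (\<lambda>E. min_degree {..<n} E \<le> 1)"
    unfolding client_can_ensure_def finished_def using client_strategy_wasteful by blast
qed

end
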